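(* Let $q$ be a prime power, $r,k,s$ integers with $0\le k\le r-1$ and $s\ge r-k$, and $0<p\le 1$. Then $$D_q(r,k,s,p)\le \frac{1-\pi_{q,r,k}}{p}.$$
   Context: A random $r\times s$ matrix over $\mathbb{F}_q$ is one whose columns are chosen independently and uniformly at random from the nonzero vectors of $\mathbb{F}_q^r$. For an $r\times s$ matrix and an integer $k\ge 0$, its $k$-dependence is the proportion of the size-$(r-k)$ subsets of its columns (as a multiset) that are linearly dependent. $D_q(r,k,s,p)$ denotes the smallest $d$ such that, with probability at least $1-p$, a random $r\times s$ matrix over $\mathbb{F}_q$ has $k$-dependence $\le d$. $\pi_{q,r,k}$ denotes the probability that $r-k$ nonzero vectors chosen independently and uniformly at random from $\mathbb{F}_q^r\setminus\{0\}$ are linearly independent. *)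

theory Defs
  imports
    "HOL-Probability.Probability"
    "HOL-Probability.Product_PMF"
    "Jordan_Normal_Form.VS_Connect"
begin

(* Throughout, a type 'a of class {field, finite} is the finite field F_q with q = CARD('a). *)

definition nonzero_vecs :: "nat \<Rightarrow> 'a::field vec set" where
  "nonzero_vecs r = carrier_vec r - {0\<^sub>v r}"

(* Linear dependence of a family, as opposed to a set: a repeated vector counts as a dependence. *)
definition dependent_family :: "nat \<Rightarrow> (nat \<Rightarrow> 'a::field vec) \<Rightarrow> nat set \<Rightarrow> bool" where
  "dependent_family r v I \<longleftrightarrow>
     \<not> inj_on v I \<or> module.lin_dep class_ring (module_vec TYPE('a) r) (v ` I)"

(* The columns of index at least s, which are irrelevant, are constantly zero. *)
definition random_columns :: "nat \<Rightarrow> nat \<Rightarrow> (nat \<Rightarrow> 'a::{field,finite} vec) pmf" where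
  "random_columns r s = Pi_pmf {..<s} (0\<^sub>v r) (\<lambda>_. pmf_of_set (nonzero_vecs r))"

definition random_mat :: "nat \<Rightarrow> nat \<Rightarrow> 'a::{field,finite} mat pmf" where
  "random_mat r s = map_pmf (\<lambda>v. mat_of_cols r (map v [0..<s])) (random_columns r s)"

(* Columns are selected by their indices, so equal columns are counted separately. *)
definition k_dependence :: "nat \<Rightarrow> 'a::field mat \<Rightarrow> real" where
  "k_dependence k A =
     real (card {I. I \<subseteq> {..<dim_col A} \<and> card I = dim_row A - k \<and>
                    dependent_family (dim_row A) (col A) I}) /
     real (card {I. I \<subseteq> {..<dim_col A} \<and> card I = dim_row A - k})"

(* A bound on a proportion is nonnegative; without this restriction there would be
   no smallest d for p = 1. *)
definition dependence_bounds ::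
    "'a::{field,finite} itself \<Rightarrow> nat \<Rightarrow> nat \<Rightarrow> nat \<Rightarrow> real \<Rightarrow> real set" where
  "dependence_bounds _ r k s p =
     {d. 0 \<le> d \<and>
         measure_pmf.prob (random_mat r s :: 'a mat pmf) {A. k_dependence k A \<le> d} \<ge> 1 - p}"

definition D :: "'a::{field,finite} itself \<Rightarrow> nat \<Rightarrow> nat \<Rightarrow> nat \<Rightarrow> real \<Rightarrow> real" where
  "D F r k s p = (LEAST d. d \<in> dependence_bounds F r k s p)"

lemma D_least:
  fixes F :: "'a::{field,finite} itself"
  assumes "0 \<le> p"
  shows "D F r k s p \<in> dependence_bounds F r k s p"
    and "\<And>d. d \<in> dependence_bounds F r k s p \<Longrightarrow> D F r k s p \<le> d"
proof -
  let ?M = "random_mat r s :: 'a mat pmf"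
  let ?B = "dependence_bounds F r k s p"
  define N where "N = card {I. I \<subseteq> {..<s} \<and> card I = r - k}"
  define V where "V = insert 0 ((\<lambda>m. real m / real N) ` {..N})"
  have finV: "finite V" by (simp add: V_def)
  have V: "k_dependence k A \<in> V" if "A \<in> set_pmf ?M" for A
  proof -
    have dims: "dim_row A = r" "dim_col A = s"
      using that by (auto simp: random_mat_def)
    have "card {I. I \<subseteq> {..<s} \<and> card I = r - k \<and> dependent_family r (col A) I} \<le> N"
      unfolding N_def by (rule card_mono) auto
    then show ?thesis by (auto simp: k_dependence_def dims V_def N_def)
  qed
  have V_le1: "v \<le> 1" if "v \<in> V" for v
    using that by (auto simp: V_def divide_le_eq_1)
  have round: "\<exists>d'\<in>V \<inter> ?B. d' \<le> d" if d: "d \<in> ?B" for d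
  proof -
    let ?S = "{v \<in> V. v \<le> d}"
    have d0: "0 \<le> d" using d by (simp add: dependence_bounds_def)
    have S: "finite ?S" "0 \<in> ?S" using finV d0 by (auto simp: V_def)
    then have M: "Max ?S \<in> ?S" by (metis Max_in empty_iff)
    have "Max ?S \<ge> 0" using S by (rule Max_ge)
    moreover have "measure_pmf.prob ?M {A. k_dependence k A \<le> d} \<le>
        measure_pmf.prob ?M {A. k_dependence k A \<le> Max ?S}"
      by (rule measure_pmf.finite_measure_mono_AE) (use V S(1) in \<open>auto simp: AE_measure_pmf_iff\<close>)
    ultimately have "Max ?S \<in> ?B" using d by (auto simp: dependence_bounds_def)
    then show ?thesis using M by blast
  qed
  have "measure_pmf.prob ?M {A. k_dependence k A \<le> 1} = 1"
    by (subst measure_pmf.prob_eq_1) (use V V_le1 in \<open>auto simp: AE_measure_pmf_iff\<close>)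
  then have "1 \<in> ?B" using assms by (simp add: dependence_bounds_def)
  with round have ne: "V \<inter> ?B \<noteq> {}" by blast
  have least: "Min (V \<inter> ?B) \<in> ?B" "\<And>d. d \<in> ?B \<Longrightarrow> Min (V \<inter> ?B) \<le> d"
    using Min_in[of "V \<inter> ?B"] ne finV round by (auto intro: Min_le order_trans simp: Bex_def)
      (metis Int_iff Min_le finite_Int order_trans)
  then have "D F r k s p = Min (V \<inter> ?B)"
    unfolding D_def by (rule Least_equality)
  with least show "D F r k s p \<in> ?B" "\<And>d. d \<in> ?B \<Longrightarrow> D F r k s p \<le> d" by auto
qed

definition indep_prob :: "'a::{field,finite} itself \<Rightarrow> nat \<Rightarrow> nat \<Rightarrow> real" where
  "indep_prob _ r k =
     measure_pmf.prob (random_columns r (r - k) :: (nat \<Rightarrow> 'a vec) pmf)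
       {v. \<not> dependent_family r v {..<r - k}}"

end

theory Submission
  imports Defs
begin

text \<open>
  By symmetry, any fixed set of \<open>r - k\<close> columns is dependent with probability exactly
  \<open>1 - \<pi>\<close>, so by linearity the expected \<open>k\<close>-dependence is \<open>1 - \<pi>\<close>. By Markov's inequality the
  \<open>k\<close>-dependence exceeds \<open>(1 - \<pi>) / p\<close> with probability at most \<open>p\<close>.
\<close>

lemma finite_carrier_vec: "finite (carrier_vec n :: 'a::finite vec set)"
proof (rule finite_subset)
  show "carrier_vec n \<subseteq> (vec_of_list ` {xs :: 'a list. length xs = n})"
  proof
    fix v :: "'a vec" assume "v \<in> carrier_vec n"
    then show "v \<in> vec_of_list ` {xs. length xs = n}"
      by (intro image_eqI[of _ _ "list_of_vec v"]) (auto simp: vec_list)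
  qed
  show "finite (vec_of_list ` {xs :: 'a list. length xs = n})"
    using finite_lists_length_eq[of "UNIV :: 'a set" n] by simp
qed

text \<open>\<open>pmf_of_set\<close> is the uniform distribution only on a nonempty finite set, so
  the support of the columns cannot be read off without this.\<close>

lemma nonzero_vecs_nonempty:
  assumes "0 < r"
  shows "nonzero_vecs r \<noteq> ({} :: 'a::field vec set)"
proof -
  have "unit_vec r 0 \<in> (nonzero_vecs r :: 'a vec set)"
    using assms by (simp add: nonzero_vecs_def)
  then show ?thesis by blast
qed

lemma set_random_columns:
  assumes "0 < r"
  shows "set_pmf (random_columns r s :: (nat \<Rightarrow> 'a::{field,finite} vec) pmf) =
    PiE_dflt {..<s} (0\<^sub>v r) (\<lambda>_. nonzero_vecs r)"
proof -
  have "finite (nonzero_vecs r :: 'a vec set)"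
    unfolding nonzero_vecs_def by (rule finite_Diff, rule finite_carrier_vec)
  then show ?thesis
    using nonzero_vecs_nonempty[OF assms, where 'a = 'a]
    by (simp add: random_columns_def set_Pi_pmf o_def)
qed

text \<open>Finite support makes every real function of the columns integrable, as both linearity of
  expectation and Markov's inequality require.\<close>

lemma finite_set_random_columns:
  assumes "0 < r"
  shows "finite (set_pmf (random_columns r s :: (nat \<Rightarrow> 'a::{field,finite} vec) pmf))"
  unfolding set_random_columns[OF assms]
  by (intro finite_PiE_dflt) (auto simp: nonzero_vecs_def finite_carrier_vec)

lemma dependent_family_cong:
  assumes "\<And>i. i \<in> I \<Longrightarrow> v i = w i"
  shows "dependent_family r v I = dependent_family r w I"
proof -
  have "inj_on v I = inj_on w I" "v ` I = w ` I"
    using assms by (auto intro!: inj_on_cong image_cong)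
  then show ?thesis by (simp add: dependent_family_def)
qed

lemma dependent_family_reindex:
  assumes "bij_betw h J I"
  shows "dependent_family r (v \<circ> h) J = dependent_family r v I"
proof -
  have h: "inj_on h J" "h ` J = I" using assms by (auto simp: bij_betw_def)
  have "inj_on (v \<circ> h) J = inj_on v I"
    using comp_inj_on_iff[OF h(1), of v] h(2) by simp
  moreover have "(v \<circ> h) ` J = v ` I" using h(2) by (metis image_comp)
  ultimately show ?thesis by (simp add: dependent_family_def)
qed

text \<open>The columns indexed by \<open>I\<close> are again independent and uniform, and numbering
  them by \<open>{..<r - k}\<close> gives exactly the family that defines \<open>indep_prob\<close>.
  Dependence is unaffected by the renumbering.\<close>

lemma prob_dependent_columns:
  assumes "I \<subseteq> {..<s}" "card I = r - k"
  shows "measure_pmf.prob (random_columns r s :: (nat \<Rightarrow> 'a::{field,finite} vec) pmf)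
    {v. dependent_family r v I} = 1 - indep_prob TYPE('a) r k"
proof -
  let ?m = "r - k"
  let ?u = "\<lambda>_::nat. pmf_of_set (nonzero_vecs r :: 'a vec set)"
  have "finite I" using assms(1) finite_subset by blast
  then obtain h0 where h0: "bij_betw h0 {..<?m} I"
    using finite_same_card_bij[of "{..<?m}" I] assms(2) by auto
  \<comment> \<open>\<open>Pi_pmf_bij_betw\<close> needs indices outside the domain to leave the range; \<open>s\<close> is not in \<open>I\<close>.\<close>
  define h where "h j = (if j < ?m then h0 j else s)" for j
  have h: "bij_betw h {..<?m} I"
    using h0 by (subst bij_betw_cong[of _ _ h0]) (simp_all add: h_def)
  have out: "h x \<notin> I" if "x \<notin> {..<?m}" for x
    using that assms(1) by (auto simp: h_def)
  \<comment> \<open>Marginalizing to \<open>I\<close> resets the other columns to the default value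
    zero; dependence over \<open>I\<close> does not see them.\<close>
  let ?f = "\<lambda>(v :: nat \<Rightarrow> 'a vec) x. if x \<in> I then v x else 0\<^sub>v r"
  have "random_columns r ?m = map_pmf (\<lambda>g. g \<circ> h) (Pi_pmf I (0\<^sub>v r) ?u)"
    unfolding random_columns_def by (rule Pi_pmf_bij_betw) (use h out in auto)
  also have "Pi_pmf I (0\<^sub>v r) ?u = map_pmf ?f (random_columns r s)"
    unfolding random_columns_def by (rule Pi_pmf_subset) (use assms in auto)
  finally have eq: "(random_columns r ?m :: (nat \<Rightarrow> 'a vec) pmf) =
    map_pmf (\<lambda>v. ?f v \<circ> h) (random_columns r s)"
    by (simp add: pmf.map_comp o_def)
  have dep: "dependent_family r (?f v \<circ> h) {..<?m} = dependent_family r v I" for v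
    unfolding dependent_family_reindex[OF h] by (rule dependent_family_cong) simp
  have "indep_prob TYPE('a) r k = measure_pmf.prob (random_columns r s) (- {v :: nat \<Rightarrow> 'a vec. dependent_family r v I})"
    unfolding indep_prob_def eq by (simp add: vimage_def dep Collect_neg_eq)
  then show ?thesis
    using measure_pmf.prob_compl[of "{v. dependent_family r v I}"
        "random_columns r s :: (nat \<Rightarrow> 'a vec) pmf"]
    by (simp add: Compl_eq_Diff_UNIV)
qed

text \<open>Counting dependent subsets by indicators prepares for linearity of expectation. The
  hypothesis ensures that \<open>col\<close> returns the vectors from which the matrix was
  built.\<close>

lemma k_dependence_mat_of_cols:
  assumes "\<And>i. i < s \<Longrightarrow> v i \<in> carrier_vec r"
  shows "k_dependence k (mat_of_cols r (map v [0..<s])) =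
    (\<Sum>I | I \<subseteq> {..<s} \<and> card I = r - k. of_bool (dependent_family r v I)) / real (s choose (r - k))"
proof -
  let ?A = "mat_of_cols r (map v [0..<s])"
  have fin: "finite {I. I \<subseteq> {..<s} \<and> card I = r - k}" by simp
  have "dependent_family r (col ?A) I = dependent_family r v I" if "I \<subseteq> {..<s}" for I
    by (rule dependent_family_cong) (use that assms in \<open>subst col_mat_of_cols; force\<close>)
  then have "{I. I \<subseteq> {..<s} \<and> card I = r - k \<and> dependent_family r (col ?A) I} =
      {I \<in> {I. I \<subseteq> {..<s} \<and> card I = r - k}. dependent_family r v I}"
    by auto
  then show ?thesis
    using fin n_subsets[of "{..<s}" "r - k"]
    by (simp add: k_dependence_def of_bool_def sum.If_cases Int_def)
qed

text \<open>The columns have dimension \<open>r\<close> only on the support of the distribution,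
  hence an almost sure identity.\<close>

lemma AE_k_dependence_random_mat:
  assumes "0 < r"
  shows "AE v in measure_pmf (random_columns r s :: (nat \<Rightarrow> 'a::{field,finite} vec) pmf).
    k_dependence k (mat_of_cols r (map v [0..<s])) =
    (\<Sum>I | I \<subseteq> {..<s} \<and> card I = r - k. of_bool (dependent_family r v I)) / real (s choose (r - k))"
  unfolding AE_measure_pmf_iff set_random_columns[OF assms]
  by (intro ballI k_dependence_mat_of_cols) (auto simp: PiE_dflt_def nonzero_vecs_def)

lemma expectation_k_dependence:
  assumes "0 < r" "r - k \<le> s"
  shows "measure_pmf.expectation (random_mat r s :: 'a::{field,finite} mat pmf) (k_dependence k) =
    1 - indep_prob TYPE('a) r k"
proof -
  let ?M = "random_columns r s :: (nat \<Rightarrow> 'a vec) pmf"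
  let ?S = "{I. I \<subseteq> {..<s} \<and> card I = r - k}"
  have S: "card ?S = s choose (r - k)" using n_subsets[of "{..<s}" "r - k"] by simp
  have "measure_pmf.expectation (random_mat r s :: 'a mat pmf) (k_dependence k) =
    measure_pmf.expectation ?M (\<lambda>v. k_dependence k (mat_of_cols r (map v [0..<s])))"
    by (simp add: random_mat_def)
  also have "\<dots> = measure_pmf.expectation ?M
      (\<lambda>v. (\<Sum>I\<in>?S. of_bool (dependent_family r v I)) / real (s choose (r - k)))"
    by (rule integral_cong_AE) (use AE_k_dependence_random_mat[OF assms(1)] in simp_all)
  also have "\<dots> = (\<Sum>I\<in>?S. measure_pmf.expectation ?M (\<lambda>v. of_bool (dependent_family r v I))) /
      real (s choose (r - k))"
    by (simp add: integrable_measure_pmf_finite finite_set_random_columns[OF assms(1)]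
        del: sum_of_bool_eq)
  also have "\<dots> = (\<Sum>I\<in>?S. 1 - indep_prob TYPE('a) r k) / real (s choose (r - k))"
  proof -
    have "measure_pmf.expectation ?M (\<lambda>v. of_bool (dependent_family r v I)) =
        measure_pmf.prob ?M {v. dependent_family r v I}" for I
      by (subst Bochner_Integration.integral_cong[OF refl, of _ _ "indicat_real {v. dependent_family r v I}"])
        (auto simp: indicator_def)
    then show ?thesis by (simp add: prob_dependent_columns)
  qed
  \<comment> \<open>All summands are equal, and \<open>r - k \<le> s\<close> makes the binomial
    coefficient nonzero, so it cancels.\<close>
  also have "\<dots> = 1 - indep_prob TYPE('a) r k"
    using assms(2) by (simp add: S)
  finally show ?thesis .
qed

lemma k_dependence_nonneg: "0 \<le> k_dependence k A"
  by (simp add: k_dependence_def)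

theorem theorem4:
  fixes r k s :: nat and p :: real
  assumes "k < r" and "r - k \<le> s" and "0 < p" and "p \<le> 1"
  shows "D TYPE('a::{field,finite}) r k s p \<le> (1 - indep_prob TYPE('a) r k) / p"
proof (rule D_least(2))
  show "0 \<le> p" using assms by simp
  let ?M = "random_mat r s :: 'a mat pmf"
  let ?e = "1 - indep_prob TYPE('a) r k"
  have r: "0 < r" using assms(1) by simp
  have int: "integrable ?M (k_dependence k)"
    by (rule integrable_measure_pmf_finite)
      (simp add: random_mat_def finite_set_random_columns[OF r])
  have exp: "measure_pmf.expectation ?M (k_dependence k) = ?e"
    by (rule expectation_k_dependence[OF r assms(2)])
  \<comment> \<open>Besides serving the case split, this gives the nonnegativity that
    \<open>dependence_bounds\<close> demands of its members.\<close>
  have e0: "0 \<le> ?e" by (simp add: indep_prob_def)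
  have "1 - p \<le> measure_pmf.prob ?M {A. k_dependence k A \<le> ?e / p}"
  \<comment> \<open>Markov's inequality needs a positive threshold. If the mean is 0, so is the
    threshold, but then the nonnegative \<open>k_dependence k\<close> vanishes almost
    surely.\<close>
  proof (cases "?e = 0")
    case True
    then have "AE A in ?M. k_dependence k A = 0"
      using integral_nonneg_eq_0_iff_AE[OF int] exp by (simp add: k_dependence_nonneg)
    then have "measure_pmf.prob ?M {A. k_dependence k A \<le> ?e / p} = 1"
      by (subst measure_pmf.prob_eq_1) (auto simp: True AE_measure_pmf_iff)
    then show ?thesis using assms(3) by simp
  next
    case False
    then have pos: "0 < ?e / p" using e0 assms(3) by simp
    have "1 - measure_pmf.prob ?M {A. k_dependence k A \<le> ?e / p} =
        measure_pmf.prob ?M (- {A. k_dependence k A \<le> ?e / p})"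
      using measure_pmf.prob_compl[of "{A. k_dependence k A \<le> ?e / p}" ?M]
      by (simp add: Compl_eq_Diff_UNIV)
    \<comment> \<open>The complement is the strict event; Markov's inequality bounds the larger
      non-strict one.\<close>
    also have "\<dots> \<le> measure_pmf.prob ?M {A. ?e / p \<le> k_dependence k A}"
      by (rule measure_pmf.finite_measure_mono) auto
    also have "\<dots> \<le> ?e / (?e / p)"
      using integral_Markov_inequality_measure[OF int, of "{}" "?e / p"] pos
      by (simp add: exp k_dependence_nonneg)
    \<comment> \<open>As \<open>?e\<close> is nonzero, the Markov bound \<open>?e / (?e / p)\<close>
      is just \<open>p\<close>.\<close>
    finally show ?thesis using False assms(3) by simp
  qed
  then show "?e / p \<in> dependence_bounds TYPE('a) r k s p"
    using e0 assms(3) by (simp add: dependence_bounds_def)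
qed

end
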